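(* Let $\mathrm{g}\ge1$, let $A(X)=X^{\mathrm{g}+1}+\sum_{j=0}^{\mathrm{g}-1}k^{(j)}X^j$, let $R(X)$ be a polynomial of degree at most $\mathrm{g}$, $F=A^2+4R$, and consider the continued fraction expansion of $Y_0=(Y+P_0)/Q_0$ at $\infty_1$ as described in the context, with all $u_n,d_n$ nonzero. Let $G=Y_0-a_0=\sum_{j\ge1}s_{j-1}X^{-j}$ be the expansion of $G$ at $\infty_1$, and let $\Delta_n=\det(s_{i+j-2})_{i,j=1}^n$ and $\Delta_n^*$ be the Hankel and shifted Hankel determinants (with $\Delta_0=1$, $\Delta_0^*=0$). Then: (i) $d_n=\dfrac{\Delta_n\Delta_{n-2}}{\Delta_{n-1}^2}$ for $n\ge2$ and $v_n=\dfrac{\Delta^*_{n-1}}{\Delta_{n-1}}-\dfrac{\Delta^*_n}{\Delta_n}$ for $n\ge1$; (ii) $s_0=u_1/2$ and, for $j\ge1$ (with the convention $s_i=0$ for $i<0$), $$s_j=-\sum_{i=2}^{\mathrm{g}+1}\big(k^{(\mathrm{g}+1-i)}+\pi_1^{(\mathrm{g}+1-i)}\big)s_{j-i}+\frac{d_1}{s_0}\Big(\sum_{i=0}^{j-2}s_is_{j-2-i}+\sum_{\ell=3}^{\mathrm{g}+2}\sum_{i=0}^{j-\ell}\rho_0^{(\mathrm{g}+2-\ell)}s_is_{j-\ell-i}\Big)+\bar s_j,$$ where $\bar s_j=s_0\rho_1^{(\mathrm{g}-j)}$ for $1\le j\le \mathrm{g}$ and $\bar s_j=0$ for $j\ge\mathrm{g}+1$;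 (iii) if $q_0=1$, $q_1=X+v_1$, $q_n=(X+v_n)q_{n-1}-d_nq_{n-2}$ for $n\ge2$ (the monic denominators of the convergents of the J-fraction $G=\cfrac{-2u_0^{-1}d_1}{X+v_1-\cfrac{d_2}{X+v_2-\cdots}}$), and $\langle\cdot\rangle$ is the linear functional on $\mathbb{C}[X]$ with $\langle X^j\rangle=s_j$, then $\langle q_nq_m\rangle=h_n\delta_{nm}$ with $h_n=\Delta_{n+1}/\Delta_n$.
   Context: Setting: $Y^2=F(X)$ defines a hyperelliptic curve with two points at infinity $\infty_1,\infty_2$ at which $Y\sim X^{\mathrm{g}+1}$ and $Y\sim -X^{\mathrm{g}+1}$ respectively as $X\to\infty$; near $\infty_1$ functions are expanded as Laurent series in $X^{-1}$ (elements of $\mathbb{C}((X^{-1}))$). Take $P_0(X)=A(X)+2d_0X^{\mathrm{g}-1}+(\text{lower terms})$ of degree $\mathrm{g}+1$ and $Q_0$ of degree $\mathrm{g}$ with leading coefficient $u_0\neq0$, such that $Q_0$ divides $F-P_0^2$, and set $Y_0=(Y+P_0)/Q_0$. The continued fraction expansion is $Y_n=a_n+1/Y_{n+1}$, $a_n=\lfloor Y_n\rfloor$ (polynomial part in $X$). One has $a_n=2(X+v_n)/u_n$, $Y_n=(Y+P_n)/Q_n=Q_{n-1}/(Y-P_n)$, where $P_n(X)=A(X)+\sum_{j=0}^{\mathrm{g}-1}\pi_n^{(j)}X^j$, $Q_n(X)=u_n\big(X^{\mathrm{g}}+\sum_{j=0}^{\mathrm{g}-1}\rho_n^{(j)}X^j\big)$,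 $\pi_n^{(\mathrm{g}-1)}=2d_n$, $\rho_n^{(\mathrm{g}-1)}=-v_n$, $F=P_n^2+Q_nQ_{n-1}$ and $4d_n+u_nu_{n-1}=0$ (with $Q_{-1}=(F-P_0^2)/Q_0$). All $u_n,d_n$ are assumed nonzero so the expansion is defined for all $n\ge0$. The shifted Hankel determinant $\Delta_n^*$ is the $n\times n$ determinant whose $(i,j)$ entry is $s_{i+j-2}$ for $1\le j\le n-1$ and $s_{i+n-1}$ for $j=n$. *)

theory Defs
  imports
    "HOL-Computational_Algebra.Computational_Algebra"
    "Jordan_Normal_Form.Determinant"
begin

text \<open>
  The field of Laurent series in the inverse of X is rendered by \<^typ>\<open>complex fls\<close>: its
  variable \<^const>\<open>fls_X\<close> is the local parameter 1/X at the point at infinity, so that X itself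
  is \<^const>\<open>fls_X_inv\<close> and the coefficient of X to the power i is the one with index -i.
\<close>

definition expand :: "complex poly \<Rightarrow> complex fls" where
  "expand p = poly (map_poly fls_const p) fls_X_inv"

text \<open>
  The polynomial part in X; \<^const>\<open>fls_prpart\<close> keeps only the strictly positive powers of X.
\<close>

definition poly_part :: "complex fls \<Rightarrow> complex poly" where
  "poly_part f = fls_prpart f + [:fls_nth f 0:]"

primrec complete_quotient :: "complex fls \<Rightarrow> nat \<Rightarrow> complex fls" where
  "complete_quotient y 0 = y"
| "complete_quotient y (Suc n) =
     1 / (complete_quotient y n - expand (poly_part (complete_quotient y n)))"

text \<open>Matrix indices start at 0 here.\<close>

definition hankel :: "(nat \<Rightarrow> complex) \<Rightarrow> nat \<Rightarrow> complex" where
  "hankel s n = det (mat n n (\<lambda>(i, j). s (i + j)))"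

definition shifted_hankel :: "(nat \<Rightarrow> complex) \<Rightarrow> nat \<Rightarrow> complex" where
  "shifted_hankel s n =
     (if n = 0 then 0
      else det (mat n n (\<lambda>(i, j). if j < n - 1 then s (i + j) else s (i + n))))"

definition moment_functional :: "(nat \<Rightarrow> complex) \<Rightarrow> complex poly \<Rightarrow> complex" where
  "moment_functional s p = (\<Sum>j\<le>degree p. coeff p j * s j)"

text \<open>
  The truncation with \<open>n\<close> levels of b i / (c i - b (i+1) / (c (i+1) - ...)).
\<close>

primrec jfrac_trunc :: "(nat \<Rightarrow> 'a::field) \<Rightarrow> (nat \<Rightarrow> 'a) \<Rightarrow> nat \<Rightarrow> nat \<Rightarrow> 'a" where
  "jfrac_trunc b c i 0 = 0"
| "jfrac_trunc b c i (Suc n) = b i / (c i - jfrac_trunc b c (Suc i) n)"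


lemma expand_0 [simp]: "expand 0 = 0"
  by (simp add: expand_def)

lemma expand_pCons: "expand (pCons a p) = fls_const a + fls_X_inv * expand p"
  by (simp add: expand_def map_poly_pCons)

lemma expand_add: "expand (p + q) = expand p + expand q"
proof (induction p q rule: poly_induct2)
  case 0 then show ?case by simp
next
  case (pCons a p b q)
  then show ?case by (simp add: expand_pCons fls_plus_const algebra_simps)
qed

lemma expand_smult: "expand (Polynomial.smult a p) = fls_const a * expand p"
  by (induction p)
     (simp_all add: expand_pCons algebra_simps flip: fls_const_mult_const)

lemma expand_minus: "expand (- p) = - expand p"
  using expand_add[of p "- p"] by (simp add: eq_neg_iff_add_eq_0 add.commute)

lemma expand_diff: "expand (p - q) = expand p - expand q"
  using expand_add[of p "- q"] by (simp add: expand_minus)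

lemma expand_mult: "expand (p * q) = expand p * expand q"
  by (induction p)
     (simp_all add: expand_pCons expand_add expand_smult algebra_simps)

lemma expand_power: "expand (p ^ n) = expand p ^ n"
proof (induction n)
  case 0 then show ?case by (simp add: expand_def)
next
  case (Suc n) then show ?case by (simp add: expand_mult)
qed

lemma expand_nth: "fls_nth (expand p) i = (if i \<le> 0 then coeff p (nat (- i)) else 0)"
proof (induction p arbitrary: i)
  case 0 then show ?case by simp
next
  case (pCons a p)
  show ?case
  proof (cases "i = 0")
    case True
    then show ?thesis
      by (simp add: expand_pCons pCons.IH fls_X_inv_times_conv_shift)
  next
    case False
    then have "nat (- i) = Suc (nat (- (i + 1)))" if "i \<le> 0" using that by auto
    with False show ?thesis
      by (auto simp: expand_pCons pCons.IH fls_X_inv_times_conv_shift)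
  qed
qed

lemma expand_eq_iff: "expand p = expand q \<longleftrightarrow> p = q"
proof
  assume h: "expand p = expand q"
  show "p = q"
  proof (rule poly_eqI)
    fix n
    from h have "fls_nth (expand p) (- int n) = fls_nth (expand q) (- int n)" by simp
    then show "coeff p n = coeff q n" by (simp add: expand_nth)
  qed
qed simp

lemma coeff_poly_part: "coeff (poly_part f) n = fls_nth f (- int n)"
  by (cases n) (simp_all add: poly_part_def)

lemma hankel_0: "hankel s 0 = 1"
  by (simp add: hankel_def)

lemma moment_functional_eq:
  assumes "degree p \<le> N"
  shows "moment_functional s p = (\<Sum>j\<le>N. coeff p j * s j)"
  unfolding moment_functional_def
  by (rule sum.mono_neutral_left) (use assms in \<open>auto simp: coeff_eq_0\<close>)

lemma moment_functional_monom: "moment_functional s (monom 1 j) = s j"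
  by (simp add: moment_functional_eq[OF degree_monom_le] of_bool_def[symmetric]
      if_distrib[of "\<lambda>x. x * _"] cong: if_cong)

lemma moment_functional_add:
  "moment_functional s (p + q) = moment_functional s p + moment_functional s q"
proof -
  let ?N = "max (degree p) (degree q)"
  show ?thesis
    by (simp add: moment_functional_eq[of _ ?N] degree_add_le distrib_right sum.distrib)
qed

lemma moment_functional_smult:
  "moment_functional s (Polynomial.smult c p) = c * moment_functional s p"
  by (simp add: moment_functional_eq[of _ "degree p"] degree_smult_le sum_distrib_left mult.assoc)

text \<open>
  The polynomials P n and Q n of the complete quotients can be generated by recursion.
  The following shows that this gives their defining properties.
\<close>

lemma complete_quotient_PQ:
  fixes F :: "complex poly" and Y :: "complex fls" and P Q a :: "nat \<Rightarrow> complex poly"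
  assumes "Y ^ 2 = expand F"
    and dvd: "Q 0 dvd F - P 0 ^ 2"
    and a: "\<And>n. a n = poly_part (complete_quotient ((Y + expand (P 0)) / expand (Q 0)) n)"
    and P: "\<And>n. P (Suc n) = a n * Q n - P n"
    and Q: "\<And>n. Q (Suc n) = (F - P (Suc n) ^ 2) div Q n"
    and nz: "\<And>n. Q n \<noteq> 0"
  shows "complete_quotient ((Y + expand (P 0)) / expand (Q 0)) n
           = (Y + expand (P n)) / expand (Q n)"
    and "F = P (Suc n) ^ 2 + Q (Suc n) * Q n"
    and "complete_quotient ((Y + expand (P 0)) / expand (Q 0)) (Suc n)
           = expand (Q n) / (Y - expand (P (Suc n)))"
proof -
  let ?y = "complete_quotient ((Y + expand (P 0)) / expand (Q 0))"
  have nz': "expand (Q n) \<noteq> 0" for n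
    using nz[of n] expand_eq_iff[of "Q n" 0] by simp
  have D: "Q n dvd F - P n ^ 2 \<and> F = P (Suc n) ^ 2 + Q (Suc n) * Q n" for n
  proof (induction n)
    have step: "F = P (Suc n) ^ 2 + Q (Suc n) * Q n" if "Q n dvd F - P n ^ 2" for n
    proof -
      have "F - P (Suc n) ^ 2 = (F - P n ^ 2) + Q n * (2 * a n * P n - a n ^ 2 * Q n)"
        by (simp add: P power2_eq_square algebra_simps)
      then have "Q n dvd F - P (Suc n) ^ 2" using that by (metis dvd_add dvd_triv_left)
      then have "Q (Suc n) * Q n = F - P (Suc n) ^ 2" by (simp add: Q)
      then show ?thesis by simp
    qed
    { case 0 show ?case using dvd step by blast }
    { case (Suc n)
      have "F - P (Suc n) ^ 2 = Q (Suc n) * Q n"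
        using Suc.IH by (metis add_diff_cancel_left')
      then have "Q (Suc n) dvd F - P (Suc n) ^ 2" by simp
      then show ?case using step by blast }
  qed
  then show F: "F = P (Suc n) ^ 2 + Q (Suc n) * Q n" for n by blast
  have E: "(Y - expand (P (Suc n))) * (Y + expand (P (Suc n))) = expand (Q (Suc n)) * expand (Q n)"
    for n
  proof -
    have "expand F = expand (P (Suc n)) ^ 2 + expand (Q (Suc n)) * expand (Q n)"
      by (subst F[of n]) (simp only: expand_add expand_power expand_mult)
    then show ?thesis using assms(1) by (simp add: power2_eq_square algebra_simps)
  qed
  have next_y: "?y (Suc n) = expand (Q n) / (Y - expand (P (Suc n)))"
    if y: "?y n = (Y + expand (P n)) / expand (Q n)" for n
  proof -
    have "?y (Suc n) = 1 / ((Y + expand (P n)) / expand (Q n) - expand (a n))"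
      by (simp add: a y)
    also have "(Y + expand (P n)) / expand (Q n) - expand (a n)
                 = (Y - expand (P (Suc n))) / expand (Q n)"
      using nz'[of n] by (simp add: P expand_diff expand_mult field_simps)
    finally show ?thesis by simp
  qed
  show Y: "?y n = (Y + expand (P n)) / expand (Q n)" for n
  proof (induction n)
    case (Suc n)
    have "Y - expand (P (Suc n)) \<noteq> 0" using E[of n] nz'[of n] nz'[of "Suc n"] by auto
    then show ?case
      using E[of n] nz'[of "Suc n"] next_y[OF Suc.IH] by (simp add: frac_eq_eq mult.commute)
  qed simp
  show "?y (Suc n) = expand (Q n) / (Y - expand (P (Suc n)))"
    by (rule next_y[OF Y])
qed

end

theory Submission
  imports Defs
begin

text \<open>
  Put \<open>G\<^sub>n = Y\<^sub>n - a\<^sub>n\<close>. As \<open>a\<^sub>n = 2(X + v\<^sub>n)/u\<^sub>n\<close>, rescaling the continued fraction of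
  \<open>G = G\<^sub>0\<close> by the factors \<open>u\<^sub>n/2\<close> turns it into the J-fraction, with tails
  \<open>T\<^sub>1 = G\<close> and \<open>T\<^sub>n\<^sub>+\<^sub>1 = - (u\<^sub>n/2) G\<^sub>n\<close>, all of order 1 in \<open>1/X\<close>. The remainder
  \<open>q\<^sub>n G - p\<^sub>n\<close> is the product of \<open>T\<^sub>1, ..., T\<^sub>n\<^sub>+\<^sub>1\<close>, hence of order \<open>n + 1\<close>: this gives the
  convergence and, since \<open>\<langle>p\<rangle>\<close> is the coefficient of \<open>1/X\<close> in \<open>p G\<close>, the orthogonality.
  Multiplying the Hankel matrices by the unitriangular matrix of the coefficients of the
  \<open>q\<^sub>n\<close> makes them triangular, with the leading coefficients of the remainders on the
  diagonal. Those, and the next ones, satisfy the three-term recurrence, which yields the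
  formulas for \<open>d\<^sub>n\<close> and \<open>v\<^sub>n\<close>. Finally, eliminating \<open>Y\<close> from \<open>Y - P\<^sub>1 = Q\<^sub>0 G\<close> and
  \<open>Q\<^sub>1 = G (Y + P\<^sub>1)\<close> gives the quadratic equation \<open>Q\<^sub>1 = 2 P\<^sub>1 G + Q\<^sub>0 G\<^sup>2\<close>, whose coefficients
  are the recursion for the moments.
\<close>

section \<open>Coefficients of products of Laurent series\<close>

text \<open>A coefficientwise bound also covers the zero series, whose \<open>fls_subdegree\<close>
  is 0 by convention, so it passes through sums and cancellations.\<close>

definition vanishes_below :: "int \<Rightarrow> 'a::zero fls \<Rightarrow> bool" where
  "vanishes_below m f \<longleftrightarrow> (\<forall>i<m. fls_nth f i = 0)"

lemma vanishes_below_mono: "vanishes_below m f \<Longrightarrow> n \<le> m \<Longrightarrow> vanishes_below n f"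
  by (simp add: vanishes_below_def)

lemma vanishes_below_add:
  "vanishes_below m f \<Longrightarrow> vanishes_below m h \<Longrightarrow> vanishes_below m (f + h :: 'a::monoid_add fls)"
  by (simp add: vanishes_below_def)

lemma vanishes_below_diff:
  "vanishes_below m f \<Longrightarrow> vanishes_below m h \<Longrightarrow> vanishes_below m (f - h :: 'a::group_add fls)"
  by (simp add: vanishes_below_def)

lemma vanishes_below_subdegree: "vanishes_below (fls_subdegree f) f"
  by (simp add: vanishes_below_def)

lemma vanishes_below_expand: "degree p \<le> n \<Longrightarrow> vanishes_below (- int n) (expand p)"
  by (auto simp: vanishes_below_def expand_nth intro!: coeff_eq_0)

text \<open>Shifting by the lower bounds turns both factors into power series, whose product has
  Cauchy sums as coefficients.\<close>

lemma fls_mult_nth_shifted: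
  fixes f h :: "'a::semiring_1 fls"
  assumes "vanishes_below m f" "vanishes_below n h"
  shows "fls_nth (f * h) (m + n + int k)
           = (\<Sum>i\<le>k. fls_nth f (m + int i) * fls_nth h (n + int (k - i)))"
proof -
  have shift: "x = fls_shift (- l) (fps_to_fls (Abs_fps (\<lambda>i. fls_nth x (l + int i))))"
    if "vanishes_below l x" for l and x :: "'a fls"
    using that by (auto simp: fls_eq_iff vanishes_below_def)
  let ?f = "Abs_fps (\<lambda>i. fls_nth f (m + int i))" and ?h = "Abs_fps (\<lambda>i. fls_nth h (n + int i))"
  have "f * h = fls_shift (- m) (fps_to_fls ?f) * fls_shift (- n) (fps_to_fls ?h)"
    using shift assms by metis
  also have "\<dots> = fls_shift (- m - n) (fps_to_fls (?f * ?h))"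
    by (simp add: fls_shifted_times_simps fls_times_fps_to_fls)
  finally show ?thesis
    by (simp add: fps_mult_nth atLeast0AtMost)
qed

lemma fls_mult_nth_lowest:
  fixes f h :: "'a::semiring_1 fls"
  assumes "vanishes_below m f" "vanishes_below n h"
  shows "fls_nth (f * h) (m + n) = fls_nth f m * fls_nth h n"
  using fls_mult_nth_shifted[OF assms, of 0] by simp

lemma vanishes_below_mult:
  fixes f h :: "'a::semiring_1 fls"
  assumes "vanishes_below m f" "vanishes_below n h"
  shows "vanishes_below (m + n) (f * h)"
  unfolding vanishes_below_def
proof safe
  fix i assume i: "i < m + n"
  \<comment> \<open>With the bound for \<open>f\<close> weakened to \<open>i - n\<close>, the index
    \<open>i\<close> becomes the lowest one. The only product left there has a factor of
    \<open>f\<close> below \<open>m\<close>.\<close>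
  then have "vanishes_below (i - n) f" using assms(1) by (auto intro: vanishes_below_mono)
  from fls_mult_nth_lowest[OF this assms(2)] i assms(1) show "fls_nth (f * h) i = 0"
    by (simp add: vanishes_below_def)
qed

lemma expand_const: "expand [:c:] = fls_const c"
  by (simp add: expand_pCons)

lemma expand_1: "expand 1 = 1"
  by (simp add: expand_const one_pCons)

lemma expand_linear_mult_nth:
  "fls_nth (expand [:c, 1:] * f) i = c * fls_nth f i + fls_nth f (i + 1)"
proof -
  have "expand [:c, 1:] * f = fls_const c * f + fls_X_inv * f"
    by (simp add: expand_pCons distrib_right)
  then show ?thesis by (simp add: fls_X_inv_times_conv_shift)
qed

lemma expand_mult_nth:
  "fls_nth (expand p * f) i = (\<Sum>j\<le>degree p. coeff p j * fls_nth f (i + int j))"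
proof -
  have "expand p = (\<Sum>j\<le>degree p. fls_const (coeff p j) * fls_X_inv ^ j)"
    by (simp add: expand_def poly_altdef degree_map_poly coeff_map_poly)
  then have "expand p * f = (\<Sum>j\<le>degree p. fls_const (coeff p j) * (fls_X_inv ^ j * f))"
    by (simp add: sum_distrib_right mult.assoc)
  then show ?thesis
    by (simp add: fls_X_inv_power_times_conv_shift fls_nth_sum)
qed

lemma moment_functional_eq_nth:
  assumes "\<And>j. s j = fls_nth G (int j + 1)"
  shows "moment_functional s p = fls_nth (expand p * G) 1"
  by (simp add: moment_functional_def expand_mult_nth assms add.commute)

section \<open>J-fractions\<close>

text \<open>
  \<open>T n\<close> is the tail of the J-fraction starting at level \<open>n\<close>; levels are counted from 1.
\<close>

locale jfraction =
  fixes \<beta> v :: "nat \<Rightarrow> complex" and T :: "nat \<Rightarrow> complex fls"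
  assumes nonzero: "n \<ge> 1 \<Longrightarrow> \<beta> n \<noteq> 0"
    and tail: "n \<ge> 1 \<Longrightarrow> T n * (expand [:v n, 1:] - T (Suc n)) = fls_const (\<beta> n)"
    and T_vanishes: "n \<ge> 1 \<Longrightarrow> vanishes_below 1 (T n)"
begin

section \<open>Convergents and their three-term recurrences\<close>

abbreviation trunc :: "nat \<Rightarrow> nat \<Rightarrow> complex fls" where
  "trunc \<equiv> jfrac_trunc (\<lambda>i. expand [:\<beta> i:]) (\<lambda>i. expand [:v i, 1:])"

fun den :: "nat \<Rightarrow> complex poly" where
  "den 0 = 1"
| "den (Suc 0) = [:v 1, 1:]"
| "den (Suc (Suc n)) = [:v (n + 2), 1:] * den (Suc n) - [:\<beta> (n + 2):] * den n"

fun num :: "nat \<Rightarrow> complex poly" where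
  "num 0 = 0"
| "num (Suc 0) = [:\<beta> 1:]"
| "num (Suc (Suc n)) = [:v (n + 2), 1:] * num (Suc n) - [:\<beta> (n + 2):] * num n"

lemma degree_den: "degree (den n) = n" and lead_coeff_den: "lead_coeff (den n) = 1"
proof -
  have "degree (den n) = n \<and> coeff (den n) n = 1"
  proof (induction n rule: den.induct)
    case (3 n)
    let ?x = "[:v (n + 2), 1:] * den (Suc n)" and ?y = "[:\<beta> (n + 2):] * den n"
    have nz: "den (Suc n) \<noteq> 0" using 3 by auto
    have x: "degree ?x = Suc (Suc n)" using 3 nz by (subst degree_mult_eq) auto
    have y: "degree ?y < Suc (Suc n)"
      using 3 degree_mult_le[of "[:\<beta> (n + 2):]" "den n"] by simp
    have "degree (?x - ?y) = Suc (Suc n)"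
      using degree_add_eq_left[of "- ?y" ?x] x y by (simp only: degree_minus uminus_add_conv_diff diff_conv_add_uminus)
    moreover have "coeff ?x (Suc (Suc n)) = 1"
      using 3 lead_coeff_mult[of "[:v (n + 2), 1:]" "den (Suc n)"] x by simp
    moreover have "coeff ?y (Suc (Suc n)) = 0" using y by (rule coeff_eq_0)
    ultimately show ?case by (simp only: den.simps coeff_diff) simp
  qed auto
  then show "degree (den n) = n" "lead_coeff (den n) = 1" by auto
qed

lemma den_nonzero: "den n \<noteq> 0"
  using lead_coeff_den[of n] by auto

text \<open>The linear terms of the two recurrences cancel, so each level contributes just a factor
  \<open>\<beta>\<close>. The result is a nonzero constant, which forces coprimality.\<close>

lemma num_den_cross: "num (Suc n) * den n - num n * den (Suc n) = [:\<Prod>i=1..Suc n. \<beta> i:]"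
proof (induction n)
  case (Suc n)
  have "num (Suc (Suc n)) * den (Suc n) - num (Suc n) * den (Suc (Suc n))
          = [:\<beta> (n + 2):] * (num (Suc n) * den n - num n * den (Suc n))"
  proof -
    have "(x * N - y * n) * D - N * (x * D - y * d) = y * (N * d - n * D)"
      for x y N n D d :: "complex poly"
      by (simp add: algebra_simps)
    then show ?thesis by (simp only: num.simps den.simps)
  qed
  also have "\<dots> = [:\<Prod>i=1..Suc (Suc n). \<beta> i:]"
    unfolding Suc.IH by (simp add: mult.commute mult.left_commute)
  finally show ?case .
qed simp

lemma coprime_num_den: "coprime (num n) (den n)"
proof (cases n)
  case (Suc m)
  show ?thesis
  proof (rule coprimeI)
    fix c assume c: "c dvd num n" "c dvd den n"
    have "c dvd [:\<Prod>i=1..Suc m. \<beta> i:]"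
      unfolding num_den_cross[of m, symmetric] using c Suc by simp
    moreover have "is_unit [:\<Prod>i=1..Suc m. \<beta> i:]"
      using nonzero by (simp add: is_unit_const_poly_iff dvd_field_iff)
    ultimately show "is_unit c" by (rule dvd_unit_imp_unit)
  qed
qed simp

text \<open>A truncation vanishes at infinity, so it cannot cancel the pole of X + v. This keeps the
  divisions in \<open>jfrac_trunc\<close> away from the default value of division by 0.\<close>

lemma level_nonzero: "expand [:v i, 1:] - trunc j n \<noteq> 0"
proof -
  have level: "fls_subdegree (expand [:c, 1:] - t) = - 1" "expand [:c, 1:] - t \<noteq> 0"
    if "vanishes_below 1 t" for c t
  proof -
    have 1: "fls_nth (expand [:c, 1:] - t) (- 1) = 1"
      using that by (simp add: expand_nth vanishes_below_def)
    moreover have "fls_nth (expand [:c, 1:] - t) k = 0" if "k < - 1" for k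
      using that \<open>vanishes_below 1 t\<close>
      by (auto simp: expand_nth vanishes_below_def coeff_eq_0)
    ultimately show "fls_subdegree (expand [:c, 1:] - t) = - 1"
      by (intro fls_subdegree_eqI) auto
    from 1 show "expand [:c, 1:] - t \<noteq> 0" by (metis fls_zero_nth zero_neq_one)
  qed
  have trunc: "vanishes_below 1 (trunc i n)" for i n
  proof (induction n arbitrary: i)
    case (Suc n)
    let ?e = "expand [:v i, 1:] - trunc (Suc i) n"
    show ?case
    \<comment> \<open>The induction runs over all \<open>i\<close>, and \<open>nonzero\<close> says
      nothing about \<open>\<beta> 0\<close>.\<close>
    proof (cases "\<beta> i = 0")
      case False
      then have "fls_subdegree (fls_const (\<beta> i) / ?e) = 1"
        using level[OF Suc] by (subst fls_divide_subdegree) auto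
      then show ?thesis by (simp add: vanishes_below_def expand_const)
    qed (simp add: vanishes_below_def)
  qed (simp add: vanishes_below_def)
  show "expand [:v i, 1:] - trunc j n \<noteq> 0" by (rule level(2)[OF trunc])
qed

text \<open>\<open>jfrac_trunc\<close> unfolds from the outermost level, whereas \<open>num\<close>
  and \<open>den\<close> grow at the innermost one. Keeping the last \<open>n\<close> levels as an
  argument of a Moebius map reconciles the two.\<close>

lemma trunc_split:
  "trunc 1 (Suc m + n)
     = (expand (num (Suc m)) - trunc (m + 2) n * expand (num m))
       / (expand (den (Suc m)) - trunc (m + 2) n * expand (den m))"
proof (induction m arbitrary: n)
  case (Suc m)
  let ?t = "trunc (m + 3) n" and ?c = "expand [:v (m + 2), 1:]" and ?b = "expand [:\<beta> (m + 2):]"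
  have nz: "?c - ?t \<noteq> 0" by (rule level_nonzero)
  have t: "trunc (m + 2) (Suc n) = ?b / (?c - ?t)"
    by (simp add: numeral_eq_Suc)
  have clear: "x - ?b / (?c - ?t) * y = (?c * x - ?b * y - ?t * x) / (?c - ?t)" for x y
    using nz by (simp add: field_simps)
  have "trunc 1 (Suc (Suc m) + n) = trunc 1 (Suc m + Suc n)" by simp
  also have "\<dots> = (expand (num (Suc m)) - ?b / (?c - ?t) * expand (num m))
       / (expand (den (Suc m)) - ?b / (?c - ?t) * expand (den m))"
    unfolding Suc.IH t ..
  also have "\<dots> = (expand (num (Suc (Suc m))) - ?t * expand (num (Suc m)))
       / (expand (den (Suc (Suc m))) - ?t * expand (den (Suc m)))"
    unfolding clear using nz
    by (simp only: num.simps den.simps expand_diff expand_mult) simp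
  finally show ?case by (simp add: numeral_eq_Suc)
qed (simp add: numeral_eq_Suc expand_1)

lemma trunc_eq: "trunc 1 n = expand (num n) / expand (den n)"
proof (cases n)
  case (Suc m)
  then show ?thesis using trunc_split[of m 0] by simp
qed simp

section \<open>Remainders and their first two coefficients\<close>

definition remainder :: "nat \<Rightarrow> complex fls" where
  "remainder n = expand (den n) * T 1 - expand (num n)"

lemma remainder_rec:
  "remainder (Suc (Suc n)) =
     expand [:v (n + 2), 1:] * remainder (Suc n) - fls_const (\<beta> (n + 2)) * remainder n"
  by (simp only: remainder_def num.simps den.simps expand_diff expand_mult expand_const)
     (simp only: algebra_simps)

lemma remainder_0: "remainder 0 = T 1"
  by (simp add: remainder_def expand_1)

lemma remainder_1: "remainder 1 = expand [:v 1, 1:] * T 1 - fls_const (\<beta> 1)"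
  by (simp add: remainder_def expand_const)

text \<open>The recurrence has the product of the first n + 1 tails as a common factor. By
  \<open>tail\<close>, the cofactor (X + v)T - \<beta> is the product of the next two tails.\<close>

lemma remainder_eq_prod: "remainder n = (\<Prod>i=1..Suc n. T i)"
proof (induction n rule: den.induct)
  case 1
  then show ?case by (simp add: remainder_0)
next
  case 2
  then show ?case using tail[of 1] by (simp add: remainder_1[simplified] algebra_simps numeral_eq_Suc)
next
  case (3 n)
  let ?p = "\<Prod>i=1..Suc n. T i"
  have "remainder (Suc (Suc n)) =
     expand [:v (n + 2), 1:] * (?p * T (n + 2)) - fls_const (\<beta> (n + 2)) * ?p"
    unfolding remainder_rec using 3 by simp
  also have "\<dots> = ?p * T (n + 2) * T (n + 3)"
    using tail[of "n + 2"] by (simp flip: tail add: algebra_simps numeral_eq_Suc)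
  finally show ?case by (simp add: numeral_eq_Suc)
qed

lemma remainder_vanishes: "vanishes_below (int n + 1) (remainder n)"
  unfolding remainder_eq_prod
proof (induction n)
  case 0
  then show ?case using T_vanishes[of 1] by simp
next
  case (Suc n)
  then show ?case
    using vanishes_below_mult[OF Suc T_vanishes[of "n + 2"]] by (simp add: add.commute add.left_commute)
qed

lemma remainder_nth_eq_0: "i \<le> int n \<Longrightarrow> fls_nth (remainder n) i = 0"
  using remainder_vanishes[of n] by (simp add: vanishes_below_def)

definition h :: "nat \<Rightarrow> complex" where
  "h n = fls_nth (remainder n) (int n + 1)"

lemma h_0: "h 0 = \<beta> 1"
proof -
  have V: "vanishes_below (- 1) (expand [:v 1, 1:] - T 2)"
    using vanishes_below_expand[of "[:v 1, 1:]" 1] T_vanishes[of 2]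
    by (intro vanishes_below_diff) (auto intro: vanishes_below_mono)
  have "fls_nth (T 2) (- 1) = 0"
    using T_vanishes[of 2] by (simp add: vanishes_below_def)
  then show ?thesis
    using fls_mult_nth_lowest[OF T_vanishes[of 1] V] tail[of 1]
    by (simp add: h_def remainder_0 expand_nth numeral_eq_Suc)
qed

text \<open>The recurrence is read at index n + 1, where the left side vanishes, its order being at
  least n + 3; the term with \<open>v\<close> vanishes too.\<close>

lemma h_Suc: "h (Suc n) = \<beta> (n + 2) * h n"
proof -
  have "fls_nth (remainder (Suc (Suc n))) (int n + 1) = 0" by (rule remainder_nth_eq_0) simp
  then show ?thesis
    unfolding remainder_rec
    by (simp add: expand_linear_mult_nth h_def remainder_nth_eq_0 add.commute)
qed

lemma h_nonzero: "h n \<noteq> 0"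
  by (induction n) (use nonzero in \<open>auto simp: h_0 h_Suc\<close>)

text \<open>
  The junk value at 0 makes the telescoping formula for \<open>v n\<close> below valid at \<open>n = 1\<close>.
\<close>

definition e :: "nat \<Rightarrow> complex" where
  "e n = (if n = 0 then 0 else fls_nth (remainder (n - 1)) (int n + 1) / h (n - 1))"

text \<open>The recurrence is read one index above that of \<open>h_Suc\<close>, where the left side
  still vanishes, and divided by \<open>h\<close>.\<close>

lemma v_eq: "n \<ge> 1 \<Longrightarrow> v n = e (n - 1) - e n"
proof (induction n rule: den.induct)
  case 2
  have "fls_nth (remainder 1) 1 = 0" by (rule remainder_nth_eq_0) simp
  then have "v 1 * h 0 + fls_nth (remainder 0) 2 = 0"
    unfolding remainder_1 by (simp add: expand_linear_mult_nth h_def remainder_0)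
  then show ?case using h_nonzero[of 0] by (simp add: e_def field_simps eq_neg_iff_add_eq_0)
next
  case (3 n)
  have "fls_nth (remainder (Suc (Suc n))) (int n + 2) = 0" by (rule remainder_nth_eq_0) simp
  then have "v (n + 2) * h (Suc n) + fls_nth (remainder (Suc n)) (int n + 3)
      = \<beta> (n + 2) * fls_nth (remainder n) (int n + 2)"
    unfolding remainder_rec by (simp add: expand_linear_mult_nth h_def add.commute)
  then show ?case using h_nonzero[of n] h_nonzero[of "Suc n"]
    by (simp add: e_def field_simps h_Suc nonzero)
qed simp

section \<open>Orthogonality and Hankel determinants\<close>

context
  fixes s :: "nat \<Rightarrow> complex"
  assumes s: "\<And>j. s j = fls_nth (T 1) (int j + 1)"
begin

text \<open>The numerator contributes a polynomial, which has no coefficient at 1/X, so only the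
  remainder is seen.\<close>

lemma moment_mult_den:
  "moment_functional s (p * den n) = (\<Sum>j\<le>degree p. coeff p j * fls_nth (remainder n) (int j + 1))"
proof -
  have "expand (p * den n) * T 1 = expand p * remainder n + expand (p * num n)"
    by (simp add: remainder_def expand_mult algebra_simps)
  then show ?thesis
    by (simp add: moment_functional_eq_nth[OF s] expand_nth expand_mult_nth[of _ "remainder n"] add.commute)
qed

lemma moment_den_less: "m < n \<Longrightarrow> moment_functional s (den m * den n) = 0"
  by (simp add: moment_mult_den degree_den remainder_nth_eq_0)

theorem moment_den: "moment_functional s (den n * den m) = (if n = m then h n else 0)"
proof (cases "n = m")
  case True
  \<comment> \<open>Only the top index survives: for j < n the remainder is evaluated below its
    order.\<close>
  have "moment_functional s (den n * den n)
      = (\<Sum>j\<in>insert n {..<n}. coeff (den n) j * fls_nth (remainder n) (int j + 1))"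
    by (simp only: moment_mult_den degree_den ivl_disj_un_singleton(2)[symmetric]) simp
  also have "\<dots> = h n"
    using lead_coeff_den[of n] by (simp add: remainder_nth_eq_0 h_def degree_den)
  finally show ?thesis using True by simp
next
  case False
  then show ?thesis
    using moment_den_less[of n m] moment_den_less[of m n] by (cases "n < m") (auto simp: mult.commute)
qed

text \<open>
  The choices of \<open>\<sigma>\<close> are the identity, for Hankel determinants, and the function moving
  \<open>n - 1\<close> to \<open>n\<close>, for the shifted ones.
\<close>

lemma det_moments:
  assumes \<sigma>: "\<And>j. j < n - 1 \<Longrightarrow> \<sigma> j = j"
  shows "det (mat n n (\<lambda>(i, j). s (i + \<sigma> j))) = (\<Prod>i<n. fls_nth (remainder i) (int (\<sigma> i) + 1))"
proof -
  let ?C = "mat n n (\<lambda>(i, j). coeff (den i) j)" and ?H = "mat n n (\<lambda>(i, j). s (i + \<sigma> j))"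
  have entry: "(?C * ?H) $$ (i, j) = fls_nth (remainder i) (int (\<sigma> j) + 1)" if "i < n" "j < n" for i j
  proof -
    have "(?C * ?H) $$ (i, j) = (\<Sum>k<n. coeff (den i) k * s (k + \<sigma> j))"
      using that by (simp add: scalar_prod_def atLeast0LessThan)
    also have "\<dots> = (\<Sum>k\<le>i. coeff (den i) k * s (k + \<sigma> j))"
      using that by (intro sum.mono_neutral_right) (auto simp: coeff_eq_0 degree_den)
    also have "\<dots> = fls_nth (expand (den i) * T 1) (int (\<sigma> j) + 1)"
      unfolding expand_mult_nth degree_den by (simp add: s add.commute add.left_commute)
    \<comment> \<open>The index is positive, so subtracting the polynomial numerator changes
      nothing.\<close>
    also have "\<dots> = fls_nth (remainder i) (int (\<sigma> j) + 1)"
      by (simp add: remainder_def expand_nth)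
    finally show ?thesis .
  qed
  have "det ?C = prod_list (diag_mat ?C)"
    by (rule det_lower_triangular[of n]) (auto simp: coeff_eq_0 degree_den)
  also have "\<dots> = (\<Prod>i<n. coeff (den i) i)"
    by (simp add: prod_list_diag_prod atLeast0LessThan)
  also have "\<dots> = 1"
    using lead_coeff_den by (simp add: degree_den)
  finally have "det ?H = det (?C * ?H)"
    by (simp add: det_mult[of _ n])
  also have "upper_triangular (?C * ?H)"
  proof (rule upper_triangularI)
    \<comment> \<open>Below the diagonal, j < i <= n - 1, so \<open>\<sigma>\<close> fixes j and the
      coefficient has index j + 1 <= i.\<close>
    fix i j assume "j < i" "i < dim_row (?C * ?H)"
    then show "(?C * ?H) $$ (i, j) = 0"
      using entry[of i j] \<sigma>[of j] by (simp add: remainder_nth_eq_0)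
  qed
  then have "det (?C * ?H) = prod_list (diag_mat (?C * ?H))"
    by (rule det_upper_triangular[of _ n]) (rule mult_carrier_mat[of _ n n], simp_all)
  also have "\<dots> = (\<Prod>i<n. (?C * ?H) $$ (i, i))"
    by (simp add: prod_list_diag_prod atLeast0LessThan)
  also have "\<dots> = (\<Prod>i<n. fls_nth (remainder i) (int (\<sigma> i) + 1))"
    by (rule prod.cong) (auto simp: entry simp del: index_mult_mat)
  finally show ?thesis .
qed

lemma hankel_eq_prod: "hankel s n = (\<Prod>i<n. h i)"
  using det_moments[of n "\<lambda>j. j"] by (simp add: hankel_def h_def)

theorem h_eq_hankel: "h n = hankel s (n + 1) / hankel s n"
  using h_nonzero by (simp add: hankel_eq_prod)

text \<open>The diagonal products of the two determinants differ in their last factor only, and the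
  quotient of these factors is \<open>e n\<close>.\<close>

lemma e_eq_hankel: "e n = shifted_hankel s n / hankel s n"
proof (cases n)
  case (Suc m)
  let ?\<sigma> = "\<lambda>j. if j < m then j else Suc m"
  have "shifted_hankel s n = det (mat n n (\<lambda>(i, j). s (i + ?\<sigma> j)))"
    unfolding shifted_hankel_def Suc by (auto intro!: arg_cong[where f = det] cong_mat)
  also have "\<dots> = (\<Prod>i<n. fls_nth (remainder i) (int (?\<sigma> i) + 1))"
    by (rule det_moments) (simp add: Suc)
  also have "\<dots> = (\<Prod>i<m. h i) * fls_nth (remainder m) (int n + 1)"
    by (simp add: Suc h_def)
  finally show ?thesis
    using h_nonzero by (simp add: e_def Suc hankel_eq_prod)
qed (simp add: e_def shifted_hankel_def)

theorem v_eq_hankel: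
  "n \<ge> 1 \<Longrightarrow> v n = shifted_hankel s (n - 1) / hankel s (n - 1) - shifted_hankel s n / hankel s n"
  by (simp add: v_eq e_eq_hankel)

theorem \<beta>_eq_hankel:
  assumes "n \<ge> 2"
  shows "\<beta> n = hankel s n * hankel s (n - 2) / hankel s (n - 1) ^ 2"
proof -
  obtain m where m: "n = Suc (Suc m)" using assms by (metis add_2_eq_Suc le_Suc_ex)
  then show ?thesis
    using h_nonzero by (simp add: hankel_eq_prod h_Suc power2_eq_square)
qed

end

text \<open>The error times \<open>den n\<close> is minus the remainder. Since \<open>den n\<close>
  has a pole of order n, the error has order at least 2n + 1; the cruder bound n suffices for the
  metric.\<close>

theorem trunc_tendsto: "(\<lambda>n. trunc 1 n) \<longlonglongrightarrow> T 1"
proof -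
  have dist: "dist (trunc 1 n) (T 1) \<le> inverse (2 ^ n)" for n
  proof (cases "trunc 1 n = T 1")
    case False
    let ?x = "trunc 1 n - T 1"
    have nz: "expand (den n) \<noteq> 0" using den_nonzero expand_eq_iff[of "den n" 0] by simp
    have "fls_subdegree (expand (den n)) = - int n"
      using lead_coeff_den[of n]
      by (intro fls_subdegree_eqI) (auto simp: expand_nth degree_den coeff_eq_0)
    moreover have eq: "?x * expand (den n) = - remainder n"
      using nz by (simp add: trunc_eq remainder_def field_simps del: One_nat_def)
    moreover have "fls_subdegree (?x * expand (den n)) = fls_subdegree ?x + fls_subdegree (expand (den n))"
      using nz False by (intro fls_subdegree_mult) auto
    moreover have "int n + 1 \<le> fls_subdegree (- remainder n)"
      using False nz eq by (intro fls_subdegree_geI) (auto simp: remainder_nth_eq_0)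
    ultimately have "int n \<le> fls_subdegree ?x" by simp
    then have "fls_subdegree ?x \<ge> 0" "n \<le> nat (fls_subdegree ?x)" by linarith+
    then show ?thesis using False by (simp add: dist_fls_def)
  qed simp
  have "(\<lambda>n. inverse (2 ^ n :: real)) \<longlonglongrightarrow> 0"
    using LIMSEQ_inverse_realpow_zero[of 2] by simp
  then show ?thesis
    by (rule metric_tendsto_imp_tendsto) (simp add: dist del: One_nat_def)
qed

end


section \<open>The continued fraction of a hyperelliptic function\<close>

lemma vanishes_below_frac_part: "vanishes_below 1 (f - expand (poly_part f))"
  by (simp add: vanishes_below_def expand_nth coeff_poly_part)

lemma degree_le_if_vanishes: "vanishes_below (- int n) (expand p) \<Longrightarrow> degree p \<le> n"
proof (rule degree_le, intro allI impI)
  fix i assume v: "vanishes_below (- int n) (expand p)" and "n < i"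
  then have "fls_nth (expand p) (- int i) = 0" by (simp add: vanishes_below_def)
  then show "coeff p i = 0" by (simp add: expand_nth)
qed

text \<open>In (Y - A)(Y + A) = R, the choice of branch prevents cancellation in Y + A, which thus
  has a pole of order m, more than the degree of R.\<close>

lemma vanishes_below_sqrt_diff:
  assumes A: "degree A = m" "lead_coeff A = 1" and R: "degree R < m"
    and Y: "Y ^ 2 = expand (A ^ 2 + R)"
    and Y_lead: "fls_subdegree Y = - int m" "fls_nth Y (- int m) = 1"
  shows "vanishes_below 1 (Y - expand A)"
proof (cases "Y = expand A")
  case False
  have nth: "fls_nth (Y + expand A) (- int m) = 2"
    using A Y_lead by (simp add: expand_nth)
  have "vanishes_below (- int m) (Y + expand A)"
    using vanishes_below_add[OF vanishes_below_subdegree[of Y] vanishes_below_expand[of A m, folded Y_lead(1)]]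
      A Y_lead by simp
  with nth have sub: "fls_subdegree (Y + expand A) = - int m"
    by (intro fls_subdegree_eqI) (auto simp: vanishes_below_def)
  from nth have nz: "Y + expand A \<noteq> 0" by (metis fls_zero_nth zero_neq_numeral)
  have prod: "(Y - expand A) * (Y + expand A) = expand R"
    using Y by (simp add: expand_add expand_power) (simp add: power2_eq_square algebra_simps)
  then have "R \<noteq> 0" using False nz by auto
  then have "expand R \<noteq> 0" using expand_eq_iff[of R 0] by simp
  then have "- int (degree R) \<le> fls_subdegree (expand R)"
    using vanishes_below_expand[of R "degree R"]
    by (intro fls_subdegree_geI) (auto simp: vanishes_below_def)
  also have "\<dots> = fls_subdegree (Y - expand A) - int m"
    unfolding prod[symmetric] using False nz sub by simp
  finally have "1 \<le> fls_subdegree (Y - expand A)" using R by linarith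
  then show ?thesis using vanishes_below_mono[OF vanishes_below_subdegree] by blast
qed (simp add: vanishes_below_def)

section \<open>Coefficients of the quadratic equation\<close>

lemma sum_atMost_flip: "(\<Sum>j\<le>n. f j) = (\<Sum>i\<le>n. f (n - i :: nat))"
  using sum.atLeastAtMost_rev[of f 0 n] by (simp add: atLeast0AtMost)

lemma square_nth:
  fixes G :: "'a::semiring_1 fls" and s :: "int \<Rightarrow> 'a"
  assumes "vanishes_below 1 G" and s: "\<And>i. s i = fls_nth G (i + 1)"
  shows "fls_nth (G * G) (l + 2) = (\<Sum>i=0..l. s i * s (l - i))"
\<comment> \<open>For negative \<open>l\<close> the sum is empty and the index lies below 2, the
  order bound of the square.\<close>
proof (cases "l < 0")
  case True
  then show ?thesis
    using vanishes_below_mult[OF assms(1) assms(1)] by (simp add: vanishes_below_def)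
next
  case False
  then obtain k where k: "l = int k" by (metis nonneg_int_cases not_less)
  have "fls_nth (G * G) (l + 2) = (\<Sum>i\<le>k. s (int i) * s (l - int i))"
    using fls_mult_nth_shifted[OF assms(1) assms(1), of k]
    by (simp add: k s add.commute of_nat_diff)
  also have "\<dots> = (\<Sum>i=0..l. s i * s (l - i))"
    by (rule sum.reindex_bij_witness[of _ nat int]) (auto simp: k)
  finally show ?thesis .
qed

text \<open>
  Both sides are the coefficient of \<open>X\<close> to the power \<open>g - j\<close> in the quadratic equation \<open>eq\<close>.
\<close>

lemma moment_recursion:
  fixes P Q Q' :: "complex poly" and s :: "int \<Rightarrow> complex"
  assumes G: "vanishes_below 1 G" and s: "\<And>i. s i = fls_nth G (i + 1)"
    and eq: "expand Q' = 2 * expand P * G + expand Q * (G * G)"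
    and P: "degree P = g + 1" "lead_coeff P = 1" "coeff P g = 0"
    and Q: "degree Q = g" and Q': "degree Q' \<le> g"
  shows "(if j \<le> g then coeff Q' (g - j) else 0) =
      2 * (s (int j) + (\<Sum>i=2..g+1. coeff P (g + 1 - i) * s (int j - int i)))
      + (coeff Q g * (\<Sum>i=0..int j - 2. s i * s (int j - 2 - i))
         + (\<Sum>l=3..g+2. \<Sum>i=0..int j - int l. coeff Q (g + 2 - l) * s i * s (int j - int l - i)))"
proof -
  let ?i = "int j - int g"
  have "fls_nth (expand P * G) ?i = (\<Sum>i\<le>g + 1. coeff P (g + 1 - i) * s (int j - int i))"
    unfolding expand_mult_nth P(1)
    by (subst sum_atMost_flip) (simp add: s of_nat_diff algebra_simps)
  \<comment> \<open>The term i = 0 is \<open>s j\<close>, as \<open>P\<close> is monic, and the term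
    i = 1 drops out because \<open>coeff P g = 0\<close>.\<close>
  also have "{..g + 1} = insert 0 (insert 1 {2..g + 1})" by auto
  finally have PG: "fls_nth (expand P * G) ?i
      = s (int j) + (\<Sum>i=2..g+1. coeff P (g + 1 - i) * s (int j - int i))"
    using P by simp
  have "fls_nth (expand Q * (G * G)) ?i
      = (\<Sum>i\<le>g. coeff Q (g - i) * (\<Sum>m=0..int j - int i - 2. s m * s (int j - int i - 2 - m)))"
  proof -
    have "fls_nth (G * G) (?i + int (g - i)) = (\<Sum>m=0..int j - int i - 2. s m * s (int j - int i - 2 - m))"
      if "i \<le> g" for i
      using square_nth[OF G s, of "int j - int i - 2"] that by (simp add: of_nat_diff)
    then show ?thesis
      unfolding expand_mult_nth Q by (subst sum_atMost_flip) simp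
  qed
  also have "{..g} = insert 0 {1..g}" by auto
  also have "(\<Sum>i\<in>insert 0 {1..g}. coeff Q (g - i) * (\<Sum>m=0..int j - int i - 2. s m * s (int j - int i - 2 - m)))
      = coeff Q g * (\<Sum>i=0..int j - 2. s i * s (int j - 2 - i))
        + (\<Sum>i=1..g. coeff Q (g - i) * (\<Sum>m=0..int j - int i - 2. s m * s (int j - int i - 2 - m)))"
    by simp
  also have "(\<Sum>i=1..g. coeff Q (g - i) * (\<Sum>m=0..int j - int i - 2. s m * s (int j - int i - 2 - m)))
      = (\<Sum>l=3..g+2. \<Sum>i=0..int j - int l. coeff Q (g + 2 - l) * s i * s (int j - int l - i))"
    by (rule sum.reindex_bij_witness[of _ "\<lambda>l. l - 2" "\<lambda>i. i + 2"])
       (auto simp: sum_distrib_left mult.assoc algebra_simps)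
  finally have QGG: "fls_nth (expand Q * (G * G)) ?i
      = coeff Q g * (\<Sum>i=0..int j - 2. s i * s (int j - 2 - i))
        + (\<Sum>l=3..g+2. \<Sum>i=0..int j - int l. coeff Q (g + 2 - l) * s i * s (int j - int l - i))" .
  have "(if j \<le> g then coeff Q' (g - j) else 0) = fls_nth (expand Q') ?i"
    by (simp add: expand_nth nat_diff_distrib')
  also have "\<dots> = 2 * fls_nth (expand P * G) ?i + fls_nth (expand Q * (G * G)) ?i"
    by (simp only: eq mult_2 distrib_right fls_plus_nth)
  finally show ?thesis unfolding PG QGG .
qed

theorem theorem4p1:
  fixes g :: nat
    and k :: "nat \<Rightarrow> complex"
    and A R F :: "complex poly"
    and Y G :: "complex fls"
    and a P Q q :: "nat \<Rightarrow> complex poly"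
    and u d v :: "nat \<Rightarrow> complex"
    and \<pi> \<rho> :: "nat \<Rightarrow> nat \<Rightarrow> complex"
    and s :: "int \<Rightarrow> complex"
    and \<Delta> \<Delta>' :: "nat \<Rightarrow> complex"
  assumes g: "g \<ge> 1"
    and A: "A = monom 1 (g + 1) + (\<Sum>j<g. monom (k j) j)"
    and R: "degree R \<le> g"
    and F: "F = A ^ 2 + 4 * R"
    and Y: "Y ^ 2 = expand F"
    and Y_lead: "fls_subdegree Y = - (int g + 1)" "fls_nth Y (- (int g + 1)) = 1"
    and P0: "degree (P 0 - A) \<le> g - 1"
    and Q0: "degree (Q 0) = g" "Q 0 dvd F - P 0 ^ 2"
    and a: "\<And>n. a n = poly_part (complete_quotient ((Y + expand (P 0)) / expand (Q 0)) n)"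
    and P: "\<And>n. P (Suc n) = a n * Q n - P n"
    and Q: "\<And>n. Q (Suc n) = (F - P (Suc n) ^ 2) div Q n"
    and u: "\<And>n. u n = coeff (Q n) g"
    and \<pi>: "\<And>n j. \<pi> n j = coeff (P n - A) j"
    and \<rho>: "\<And>n j. \<rho> n j = coeff (Q n) j / u n"
    and d: "\<And>n. d n = \<pi> n (g - 1) / 2"
    and v: "\<And>n. v n = - \<rho> n (g - 1)"
    and nonzero: "\<And>n. u n \<noteq> 0" "\<And>n. d n \<noteq> 0"
    and G: "G = (Y + expand (P 0)) / expand (Q 0) - expand (a 0)"
    and s: "\<And>j. s j = (if j < 0 then 0 else fls_nth G (j + 1))"
    and \<Delta>: "\<And>n. \<Delta> n = hankel (\<lambda>i. s (int i)) n"
    and \<Delta>': "\<And>n. \<Delta>' n = shifted_hankel (\<lambda>i. s (int i)) n"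
    and q: "q 0 = 1" "q 1 = [:v 1, 1:]"
      "\<And>n. n \<ge> 2 \<Longrightarrow> q n = [:v n, 1:] * q (n - 1) - [:d n:] * q (n - 2)"
  shows
    "((\<forall>n\<ge>2. d n = \<Delta> n * \<Delta> (n - 2) / \<Delta> (n - 1) ^ 2)
     \<and> (\<forall>n\<ge>1. v n = \<Delta>' (n - 1) / \<Delta> (n - 1) - \<Delta>' n / \<Delta> n))
     \<and> (s 0 = u 1 / 2
       \<and> (\<forall>j::nat\<ge>1. s (int j) =
            - (\<Sum>i=2..g+1. (k (g + 1 - i) + \<pi> 1 (g + 1 - i)) * s (int j - int i))
            + d 1 / s 0 *
                ((\<Sum>i=0..int j - 2. s i * s (int j - 2 - i))
                 + (\<Sum>l=3..g+2. \<Sum>i=0..int j - int l. \<rho> 0 (g + 2 - l) * s i * s (int j - int l - i)))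
            + (if j \<le> g then s 0 * \<rho> 1 (g - j) else 0)))
     \<and> ((\<lambda>n. jfrac_trunc (\<lambda>i. expand [:if i = 1 then - 2 * d 1 / u 0 else d i:])
                        (\<lambda>i. expand [:v i, 1:]) 1 n) \<longlonglongrightarrow> G
       \<and> (\<forall>n. lead_coeff (q n) = 1 \<and>
              (\<exists>p. coprime p (q n) \<and>
                   jfrac_trunc (\<lambda>i. expand [:if i = 1 then - 2 * d 1 / u 0 else d i:])
                               (\<lambda>i. expand [:v i, 1:]) 1 n = expand p / expand (q n)))
       \<and> (\<forall>n m. moment_functional (\<lambda>i. s (int i)) (q n * q m)
                  = (if n = m then \<Delta> (n + 1) / \<Delta> n else 0)))"
proof -
  let ?y = "complete_quotient ((Y + expand (P 0)) / expand (Q 0))"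
  have A_coeff: "coeff A i = (if i = g + 1 then 1 else if i < g then k i else 0)" for i
    by (simp add: A coeff_sum coeff_monom)
  have A_deg: "degree A = g + 1" "lead_coeff A = 1"
  proof -
    show "degree A = g + 1"
      by (rule order_antisym) (auto intro: degree_le le_degree simp: A_coeff)
    then show "lead_coeff A = 1" by (simp add: A_coeff)
  qed
  have Q_nz: "Q n \<noteq> 0" for n using nonzero(1)[of n] by (auto simp: u)
  have EQ_nz: "expand (Q n) \<noteq> 0" for n using Q_nz[of n] expand_eq_iff[of "Q n" 0] by simp
  note CQ = complete_quotient_PQ[where P = P and Q = Q and a = a, OF Y Q0(2) a P Q Q_nz]
  define f where "f n = ?y n - expand (a n)" for n
  have f_vanishes: "vanishes_below 1 (f n)" for n
    by (simp add: f_def a vanishes_below_frac_part)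
  have f_0: "f 0 = G" by (simp add: f_def G)
  have y_Suc: "?y (Suc n) = 1 / f n" for n by (simp add: f_def a)
  \<comment> \<open>This relation and \<open>Q_Suc\<close> below are the two halves of the
    factorisation of F - P^2.\<close>
  have YP: "Y - expand (P (Suc n)) = expand (Q n) * f n" for n
    using EQ_nz[of n] by (simp add: f_def CQ(1) P expand_diff expand_mult field_simps)
  have YA: "vanishes_below 1 (Y - expand A)"
  proof (rule vanishes_below_sqrt_diff)
    have "degree (4 * R) \<le> g"
      using degree_mult_le[of 4 R] R by simp
    then show "degree (4 * R) < g + 1" by simp
  qed (use A_deg Y Y_lead in \<open>simp_all add: F algebra_simps\<close>)
  have Q_Suc: "expand (Q (Suc n)) = f n * (Y + expand (P (Suc n)))" for n
  proof -
    have "expand F = expand (P (Suc n)) ^ 2 + expand (Q (Suc n)) * expand (Q n)"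
      by (subst CQ(2)[of n]) (simp only: expand_add expand_power expand_mult)
    then have "expand (Q (Suc n)) * expand (Q n)
        = (Y - expand (P (Suc n))) * (Y + expand (P (Suc n)))"
      using Y by (simp add: power2_eq_square algebra_simps)
    then show ?thesis using EQ_nz[of n] by (simp add: YP)
  qed
  \<comment> \<open>The top two coefficients come from 2A, since Y - A and P - A are too small. The
    second is 0 because A has no term of degree g.\<close>
  have YPA: "vanishes_below (- int g - 1) (Y + expand (P n))"
      "fls_nth (Y + expand (P n)) (- int g - 1) = 2" "fls_nth (Y + expand (P n)) (- int g) = 0"
    if "degree (P n - A) \<le> g - 1" for n
  proof -
    have split: "Y + expand (P n) = (Y - expand A) + expand (P n - A) + (expand A + expand A)"
      by (simp add: expand_diff)
    have nth: "fls_nth (Y + expand (P n)) i = 2 * fls_nth (expand A) i" if i: "i \<le> - int g" for i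
    proof -
      have "fls_nth (Y - expand A) i = 0" using YA i by (simp add: vanishes_below_def)
      moreover have "degree (P n - A) < nat (- i)"
        using i g \<open>degree (P n - A) \<le> g - 1\<close> by linarith
      then have "fls_nth (expand (P n - A)) i = 0" by (simp only: expand_nth coeff_eq_0 if_cancel)
      ultimately show ?thesis unfolding split fls_plus_nth by simp
    qed
    show "vanishes_below (- int g - 1) (Y + expand (P n))"
      using A_deg by (auto simp: vanishes_below_def nth expand_nth simp del: fls_plus_nth intro!: coeff_eq_0)
    have "nat (int g + 1) = g + 1" by simp
    then show "fls_nth (Y + expand (P n)) (- int g - 1) = 2" "fls_nth (Y + expand (P n)) (- int g) = 0"
      by (simp_all add: nth expand_nth A_coeff del: fls_plus_nth)
  qed
  \<comment> \<open>P - A is (Y - A) minus Q f of the previous stage, so the bound on Q gives that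
    on P - A. Then \<open>Q_Suc\<close> gives the next bound on Q.\<close>
  have PQ_deg: "degree (P n - A) \<le> g - 1 \<and> degree (Q n) \<le> g" for n
  proof (induction n)
    case 0
    then show ?case using P0 Q0(1) by simp
  next
    case (Suc n)
    have "expand (P (Suc n) - A) = (Y - expand A) - expand (Q n) * f n"
      by (simp add: expand_diff flip: YP)
    moreover have "vanishes_below (- int g + 1) (expand (Q n) * f n)"
      using Suc by (intro vanishes_below_mult vanishes_below_expand f_vanishes) auto
    ultimately have "vanishes_below (- int (g - 1)) (expand (P (Suc n) - A))"
      using g YA by (simp add: vanishes_below_def of_nat_diff)
    then have P_deg: "degree (P (Suc n) - A) \<le> g - 1" by (rule degree_le_if_vanishes)
    have "vanishes_below (1 + (- int g - 1)) (expand (Q (Suc n)))"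
      unfolding Q_Suc by (intro vanishes_below_mult f_vanishes YPA P_deg)
    then have "degree (Q (Suc n)) \<le> g" by (intro degree_le_if_vanishes) simp
    with P_deg show ?case by blast
  qed
  have Q_deg: "degree (Q n) = g" for n
    using PQ_deg[of n] nonzero(1)[of n] by (auto simp: u intro: order_antisym le_degree)
  note YPA = YPA[OF conjunct1[OF PQ_deg]]
  have Q_vanishes: "vanishes_below (- int g) (expand (Q n))" for n
    by (rule vanishes_below_expand) (simp add: Q_deg)

  \<comment> \<open>Partial quotients and the relation between d and u\<close>
  have a_eq: "a n = Polynomial.smult (2 / u n) [:v n, 1:]" for n
  proof -
    \<comment> \<open>Comparing the top two coefficients of this product determines the two
      coefficients of the partial quotient.\<close>
    have yQ: "?y n * expand (Q n) = Y + expand (P n)" using EQ_nz[of n] CQ(1)[of n] by simp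
    have "fls_subdegree (Y + expand (P n)) = - int g - 1"
      using YPA[of n] by (intro fls_subdegree_eqI) (auto simp: vanishes_below_def)
    moreover have "fls_subdegree (expand (Q n)) = - int g"
      using Q_vanishes[of n] nonzero(1)[of n]
      by (intro fls_subdegree_eqI) (auto simp: vanishes_below_def expand_nth u)
    moreover have "Y + expand (P n) \<noteq> 0" using YPA(2)[of n] by (metis fls_zero_nth zero_neq_numeral)
    ultimately have "fls_subdegree (?y n) = - 1"
      unfolding CQ(1) using EQ_nz[of n] by (subst fls_divide_subdegree) auto
    then have y_vanishes: "vanishes_below (- 1) (?y n)" using vanishes_below_subdegree[of "?y n"] by simp
    have idx: "- 1 + - int g + int 0 = - int g - 1" "- 1 + - int g + int 1 = - int g" by simp_all
    have y1: "fls_nth (?y n) (- 1) * u n = 2"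
      using fls_mult_nth_shifted[OF y_vanishes Q_vanishes[of n], of 0]
      unfolding yQ idx YPA(2) by (simp add: expand_nth u)
    have "nat (int g - 1) = g - 1" by simp
    then have "fls_nth (?y n) 0 * u n + fls_nth (?y n) (- 1) * coeff (Q n) (g - 1) = 0"
      using fls_mult_nth_shifted[OF y_vanishes Q_vanishes[of n], of 1] g
      unfolding yQ idx YPA(3) by (simp add: expand_nth u add.commute)
    then have y0: "fls_nth (?y n) 0 = fls_nth (?y n) (- 1) * v n"
      using nonzero(1)[of n] by (simp add: v \<rho> field_simps eq_neg_iff_add_eq_0)
    have y1': "fls_nth (?y n) (- 1) = 2 / u n" using y1 nonzero(1)[of n] by (simp add: field_simps)
    show ?thesis
    proof (rule poly_eqI)
      fix i
      have "fls_nth (?y n) (- int i) = 0" if "i \<ge> 2"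
        using y_vanishes that by (simp add: vanishes_below_def)
      then show "coeff (a n) i = coeff (Polynomial.smult (2 / u n) [:v n, 1:]) i"
        using y0 y1' by (cases i rule: nat.exhaust; cases "i - 1")
          (auto simp: a coeff_poly_part coeff_pCons split: nat.split)
    qed
  qed
  have f_lead: "u (Suc n) = 2 * fls_nth (f n) 1" for n
    using fls_mult_nth_lowest[OF f_vanishes[of n] YPA(1)[of "Suc n"]]
    unfolding Q_Suc[symmetric] YPA(2) by (simp add: u expand_nth)
  have d_Suc: "4 * d (Suc n) = - u n * u (Suc n)" for n
  proof -
    \<comment> \<open>The coefficient of X^(g-1) is compared; Y - A has none, being of positive
      order in 1/X.\<close>
    have "expand (P (Suc n) - A) = (Y - expand A) - expand (Q n) * f n"
      by (simp add: expand_diff flip: YP)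
    then have "fls_nth (expand (P (Suc n) - A)) (- int g + 1)
        = - (fls_nth (expand (Q n)) (- int g) * fls_nth (f n) 1)"
      using YA g fls_mult_nth_lowest[OF Q_vanishes[of n] f_vanishes[of n]]
      by (simp add: vanishes_below_def)
    moreover have "nat (int g - 1) = g - 1" by simp
    ultimately have "\<pi> (Suc n) (g - 1) = - (u n * fls_nth (f n) 1)"
      using g by (simp add: \<pi> u expand_nth)
    then show ?thesis by (simp add: d f_lead)
  qed

  \<comment> \<open>Rescaling to a J-fraction\<close>
  define \<beta> where "\<beta> i = (if i = 1 then - 2 * d 1 / u 0 else d i)" for i
  define T where "T n = (if n = 1 then G else - (fls_const (u (n - 1) / 2) * f (n - 1)))" for n
  have \<beta>_eq: "\<beta> i = d i" if "i \<ge> 2" for i using that by (simp add: \<beta>_def)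
  have \<beta>_1: "\<beta> 1 = u 1 / 2"
    using d_Suc[of 0] nonzero(1)[of 0] by (simp add: \<beta>_def field_simps)
  have f_nz: "f n \<noteq> 0" for n
    using f_lead[of n] nonzero(1)[of "Suc n"] by auto
  have level: "f n * (expand [:v (Suc n), 1:] - T (n + 2)) = fls_const (u (Suc n) / 2)" for n
  proof -
    have "[:v (Suc n), 1:] = Polynomial.smult (u (Suc n) / 2) (a (Suc n))"
      using nonzero(1)[of "Suc n"] by (simp add: a_eq)
    then have "expand [:v (Suc n), 1:] - T (n + 2) = fls_const (u (Suc n) / 2) * (expand (a (Suc n)) + f (Suc n))"
      by (simp add: T_def expand_smult algebra_simps)
    also have "expand (a (Suc n)) + f (Suc n) = 1 / f n"
      by (simp add: f_def[of "Suc n"] flip: y_Suc)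
    finally show ?thesis using f_nz[of n] by simp
  qed
  interpret J: jfraction \<beta> v T
  proof
    fix n :: nat assume n: "n \<ge> 1"
    then obtain m where m: "n = Suc m" by (cases n) auto
    show "\<beta> n \<noteq> 0" using nonzero by (simp add: \<beta>_def)
    show "vanishes_below 1 (T n)"
      using f_vanishes[of "n - 1"] f_vanishes[of 0] by (simp add: T_def f_0 vanishes_below_def)
    show "T n * (expand [:v n, 1:] - T (Suc n)) = fls_const (\<beta> n)"
    proof (cases m)
      case 0
      then show ?thesis using level[of 0] by (simp add: m T_def f_0 numeral_eq_Suc \<beta>_1[unfolded One_nat_def])
    next
      case (Suc l)
      \<comment> \<open>The scaling factors of two successive levels combine to -u_m u_n / 4, which
        is d_n by \<open>d_Suc\<close>.\<close>
      have "T n * (expand [:v n, 1:] - T (Suc n))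
          = - fls_const (u m / 2) * (f m * (expand [:v n, 1:] - T (Suc n)))"
        by (simp add: T_def m Suc mult.assoc)
      also have "\<dots> = fls_const (- (u m / 2 * (u n / 2)))"
        using level[of m] by (simp add: m)
      also have "- (u m / 2 * (u n / 2)) = \<beta> n"
        using d_Suc[of m] by (simp add: \<beta>_def m Suc field_simps)
      finally show ?thesis .
    qed
  qed
  have T_1: "T 1 = G" by (simp add: T_def)
  have q_den: "q n = J.den n" for n
  proof (induction n rule: J.den.induct)
    case (3 n)
    then show ?case using q(3)[of "Suc (Suc n)"] by (simp add: \<beta>_eq)
  qed (use q in auto)

  have G_vanishes: "vanishes_below 1 G" using f_vanishes[of 0] by (simp add: f_0)
  \<comment> \<open>The convention for negative indices agrees with the vanishing of G at
    infinity.\<close>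
  have s_nth: "s i = fls_nth G (i + 1)" for i
    using G_vanishes by (simp add: s vanishes_below_def)
  have s_T: "s (int j) = fls_nth (T 1) (int j + 1)" for j by (simp only: s_nth T_1)
  have s_0: "s 0 = u 1 / 2" using f_lead[of 0] by (simp add: s_nth f_0)

  \<comment> \<open>Recursion for the moments\<close>
  have "s (int j) =
            - (\<Sum>i=2..g+1. (k (g + 1 - i) + \<pi> 1 (g + 1 - i)) * s (int j - int i))
            + d 1 / s 0 *
                ((\<Sum>i=0..int j - 2. s i * s (int j - 2 - i))
                 + (\<Sum>l=3..g+2. \<Sum>i=0..int j - int l. \<rho> 0 (g + 2 - l) * s i * s (int j - int l - i)))
            + (if j \<le> g then s 0 * \<rho> 1 (g - j) else 0)" (is "_ = - ?S1 + d 1 / s 0 * (?S2 + ?S3) + ?S4") for j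
  proof -
    have P1_coeff: "coeff (P 1) i = coeff A i + \<pi> 1 i" for i by (simp add: \<pi>)
    have Q0_coeff: "coeff (Q 0) i = u 0 * \<rho> 0 i" for i using nonzero(1)[of 0] by (simp add: \<rho>)
    have P1_deg: "degree (P 1 - A) < g" using PQ_deg[of 1] g by linarith
    then have \<pi>_0: "\<pi> 1 i = 0" if "i \<ge> g" for i using that P1_deg unfolding \<pi> by (intro coeff_eq_0) linarith
    have "degree (P 1) = g + 1"
      using degree_add_eq_left[of "P 1 - A" A] P1_deg A_deg by (simp del: One_nat_def)
    moreover from this have "lead_coeff (P 1) = 1" by (simp add: P1_coeff A_coeff \<pi>_0 del: One_nat_def)
    moreover have "coeff (P 1) g = 0" by (simp add: P1_coeff A_coeff \<pi>_0 del: One_nat_def)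
    moreover have "expand (Q 1) = 2 * expand (P 1) * G + expand (Q 0) * (G * G)"
    proof -
      have "Y = expand (P 1) + expand (Q 0) * G" using YP[of 0] by (simp add: f_0 algebra_simps)
      then show ?thesis using Q_Suc[of 0] by (simp add: f_0 algebra_simps)
    qed
    ultimately have "(if j \<le> g then coeff (Q 1) (g - j) else 0) =
      2 * (s (int j) + (\<Sum>i=2..g+1. coeff (P 1) (g + 1 - i) * s (int j - int i)))
      + (coeff (Q 0) g * ?S2
         + (\<Sum>l=3..g+2. \<Sum>i=0..int j - int l. coeff (Q 0) (g + 2 - l) * s i * s (int j - int l - i)))"
      by (intro moment_recursion[OF G_vanishes s_nth]) (simp_all add: Q_deg)
    also have "(\<Sum>i=2..g+1. coeff (P 1) (g + 1 - i) * s (int j - int i)) = ?S1"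
      \<comment> \<open>For i >= 2 the index g + 1 - i is below g, where the coefficients of
        \<open>A\<close> are the \<open>k\<close>.\<close>
      by (rule sum.cong) (simp_all only: P1_coeff, auto simp: A_coeff)
    also have "(\<Sum>l=3..g+2. \<Sum>i=0..int j - int l. coeff (Q 0) (g + 2 - l) * s i * s (int j - int l - i))
        = u 0 * ?S3"
      by (simp only: Q0_coeff sum_distrib_left mult.assoc)
    also have "(if j \<le> g then coeff (Q 1) (g - j) else 0) = 2 * ?S4"
      using nonzero(1)[of 1] by (simp add: \<rho> s_0)
    finally have "2 * ?S4 = 2 * (s (int j) + ?S1) + u 0 * (?S2 + ?S3)"
      by (simp add: u distrib_left)
    \<comment> \<open>After halving the equation, -u_0 / 2 is the factor of the quadratic
      terms.\<close>
    moreover have "d 1 / s 0 = - u 0 / 2"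
      using d_Suc[of 0] nonzero(1)[of 1] by (simp add: s_0 field_simps)
    moreover have "x = - y + c * w + z" if "2 * z = 2 * (x + y) + t * w" "c = - t / 2"
      for x y z w t c :: complex
      unfolding that(2) using that(1) by (simp add: field_simps)
    ultimately show ?thesis by blast
  qed
  moreover have "\<forall>n\<ge>2. d n = \<Delta> n * \<Delta> (n - 2) / \<Delta> (n - 1) ^ 2"
    using J.\<beta>_eq_hankel[OF s_T] by (simp add: \<Delta> \<beta>_eq)
  moreover have "\<forall>n\<ge>1. v n = \<Delta>' (n - 1) / \<Delta> (n - 1) - \<Delta>' n / \<Delta> n"
    using J.v_eq_hankel[OF s_T] by (simp add: \<Delta> \<Delta>')
  moreover have "\<forall>n m. moment_functional (\<lambda>i. s (int i)) (q n * q m)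
                  = (if n = m then \<Delta> (n + 1) / \<Delta> n else 0)"
    unfolding q_den \<Delta> using J.moment_den[OF s_T] J.h_eq_hankel[OF s_T] by simp
  moreover have "(\<lambda>n. J.trunc 1 n) \<longlonglongrightarrow> G"
    using J.trunc_tendsto by (simp only: T_1)
  moreover have "lead_coeff (q n) = 1 \<and> (\<exists>p. coprime p (q n) \<and> J.trunc 1 n = expand p / expand (q n))" for n
    unfolding q_den using J.lead_coeff_den J.coprime_num_den J.trunc_eq by blast
  ultimately show ?thesis using s_0 unfolding \<beta>_def by blast
qed

end
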